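(* Let $p<q<r$ be odd primes, $l,s,t\ge 1$ integers, $n=p^lq^sr^t$ and $m=\phi(n)$. Then $$\mathrm{Cond}(V_{\Phi_n})\le 2\,\phi(\mathrm{rad}(n))^2\,m^2.$$
   Context: $\phi$ is Euler's totient, $\mathrm{rad}(n)$ is the product of the distinct primes dividing $n$, $\Phi_n$ is the $n$-th cyclotomic polynomial, of degree $m=\phi(n)$, and $\zeta_1,\dots,\zeta_m\in\mathbb{C}$ are the primitive $n$-th roots of unity (in any fixed order). $V_{\Phi_n}$ is the $m\times m$ Vandermonde matrix whose $(i,j)$ entry is $\zeta_i^{\,j-1}$, $1\le i,j\le m$. For a complex matrix $A=(a_{ij})$, $\|A\|=\sqrt{\sum_{i,j}|a_{ij}|^2}$ is the Frobenius norm, and for invertible $A$, $\mathrm{Cond}(A)=\|A\|\,\|A^{-1}\|$. *)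

theory Defs
  imports
    "HOL-Number_Theory.Totient"
    "Jordan_Normal_Form.Gauss_Jordan_Elimination"
begin

definition rad :: "nat \<Rightarrow> nat" where
  "rad n = (\<Prod>p\<in>prime_factors n. p)"

definition primitive_roots_of_unity :: "nat \<Rightarrow> complex set" where
  "primitive_roots_of_unity n = {z. z ^ n = 1 \<and> (\<forall>k. 0 < k \<and> k < n \<longrightarrow> z ^ k \<noteq> 1)}"

text \<open>
  The nodes \<open>\<zeta> 1, \<dots>, \<zeta> m\<close> are numbered from 1, whereas matrix indices start at 0: row \<open>i\<close>
  belongs to the node \<open>\<zeta> (i + 1)\<close>, and column \<open>j\<close> holds the \<open>j\<close>-th powers.
\<close>
definition vandermonde_mat :: "nat \<Rightarrow> (nat \<Rightarrow> complex) \<Rightarrow> complex mat" where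
  "vandermonde_mat m \<zeta> = mat m m (\<lambda>(i, j). \<zeta> (i + 1) ^ j)"

definition frobenius_norm :: "complex mat \<Rightarrow> real" where
  "frobenius_norm A = sqrt (\<Sum>i<dim_row A. \<Sum>j<dim_col A. (cmod (A $$ (i, j)))\<^sup>2)"

text \<open>
  Meaningful for invertible matrices only: \<^const>\<open>mat_inverse\<close> returns \<^const>\<open>None\<close> on a singular
  matrix.
\<close>
definition cond_number :: "complex mat \<Rightarrow> real" where
  "cond_number A = frobenius_norm A * frobenius_norm (the (mat_inverse A))"

lemma cond_number_eq:
  assumes A: "A \<in> carrier_mat n n" and B: "B \<in> carrier_mat n n"
    and AB: "A * B = 1\<^sub>m n" and BA: "B * A = 1\<^sub>m n"
  shows "cond_number A = frobenius_norm A * frobenius_norm B"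
proof (cases "mat_inverse A")
  case None
  have "A \<in> Units (ring_mat TYPE(complex) n ())"
    using A B AB BA by (auto simp: Units_def ring_mat_def)
  then show ?thesis using mat_inverse(1)[OF A None, where b = "()"] by blast
next
  case (Some C)
  from mat_inverse(2)[OF A Some] have C: "C \<in> carrier_mat n n" "C * A = 1\<^sub>m n" by auto
  have "C = C * (A * B)" using C AB by simp
  also have "\<dots> = (C * A) * B" using assoc_mult_mat[OF C(1) A B] by (rule sym)
  also have "\<dots> = B" using B C by simp
  finally show ?thesis by (simp add: cond_number_def Some)
qed

end

theory Submission
  imports Defs "HOL-Computational_Algebra.Polynomial_FPS" "Jordan_Normal_Form.Determinant"
begin

text \<open>
  Let \<open>N = pqr\<close>, \<open>k = n / N\<close> and \<open>M = \<phi>(N)\<close>, so that \<open>m = kM\<close> and \<open>\<Phi>\<^sub>n(x) = F(x ^ k)\<close> with \<open>F = \<Phi>\<^sub>N\<close>.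
  All entries of the Vandermonde matrix have modulus 1, so its norm is \<open>m\<close>. Its inverse has entries
  \<open>b\<^sub>j(\<zeta>) / \<Phi>\<^sub>n'(\<zeta>)\<close>, where \<open>\<Phi>\<^sub>n(x) / (x - \<zeta>) = \<Sum>j. b\<^sub>j(\<zeta>) x ^ j\<close>.

  The coefficients of \<open>F\<close> are at most \<open>2p\<close> in modulus (Bang), because
  \<open>F(x) = \<Phi>\<^sub>p\<^sub>q(x ^ r) (1 + \<dots> + x ^ (p - 1)) (1 - x ^ q) / (1 - x ^ (pq))\<close>; hence \<open>\<bar>b\<^sub>j(\<zeta>)\<bar> \<le> 2pM\<close>.

  Differentiating the inclusion-exclusion formula for \<open>F\<close> at a root \<open>\<omega>\<close> gives
  \<open>16 \<bar>F'(\<omega>)\<bar> \<ge> N \<bar>\<omega> ^ p - 1\<bar> \<bar>\<omega> ^ q - 1\<bar> \<bar>\<omega> ^ r - 1\<bar>\<close>. The last two factors are bounded below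
  pointwise; for the first one this would lose too much, and it is averaged over all \<open>\<omega>\<close> by
  \<open>\<Sum> 1 / \<bar>z - 1\<bar>\<^sup>2 = (d\<^sup>2 - 1) / 12\<close> over the \<open>d\<close>-th roots of unity \<open>z \<noteq> 1\<close>. What remains is
  \<open>N\<^sup>2 p\<^sup>3 \<le> 27 M\<^sup>3\<close>.
\<close>

section \<open>Roots of unity\<close>

lemma coeff_pcompose_monom:
  fixes p :: "'a :: comm_ring_1 poly"
  assumes "k > 0"
  shows "coeff (pcompose p (monom 1 k)) i = (if k dvd i then coeff p (i div k) else 0)"
proof (induction p arbitrary: i)
  case (pCons a p)
  show ?case
  proof (cases "i < k")
    case True
    then show ?thesis
      by (cases i) (auto simp: pcompose_pCons coeff_monom_mult dest: dvd_imp_le)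
  next
    case False
    then have i: "k dvd i - k \<longleftrightarrow> k dvd i" "i div k = Suc ((i - k) div k)" "i > 0"
      using assms le_div_geq[of k i] by (auto simp: dvd_diff_nat le_imp_diff_is_add elim: dvd_diffD)
    then show ?thesis using False
      by (auto simp: pcompose_pCons coeff_monom_mult pCons.IH coeff_pCons split: nat.splits)
  qed
qed auto

lemma pcompose_monom_monom:
  "pcompose (monom 1 i) (monom 1 k) = (monom 1 (k * i) :: 'a :: comm_ring_1 poly)"
  by (induction i) (simp_all add: monom_0 monom_Suc pcompose_pCons mult_monom add.commute)

text \<open>Both sides have degree at most \<open>n\<close>, share the coefficient at
  \<open>n\<close>, and vanish at the \<open>n\<close> distinct roots of unity, so they
  coincide.\<close>

lemma prod_linear_roots_unity:
  assumes "n > 0"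
  shows "(\<Prod>z | z ^ n = 1. [:-z, 1:]) = (monom 1 n - 1 :: complex poly)"
proof (rule poly_eqI_degree_lead_coeff[where n = n and A = "{z. z ^ n = 1}"])
  have fin: "finite {z::complex. z ^ n = 1}"
    using finite_roots_unity[of n] assms by simp
  have d: "degree (\<Prod>z\<in>{z::complex. z ^ n = 1}. [:-z, 1:]) = n"
    using card_roots_unity_eq[OF assms] by (simp add: degree_prod_eq_sum_degree)
  then show "degree (\<Prod>z\<in>{z::complex. z ^ n = 1}. [:-z, 1:]) \<le> n" by simp
  show "coeff (\<Prod>z\<in>{z::complex. z ^ n = 1}. [:-z, 1:]) n = coeff (monom 1 n - 1) n"
    using lead_coeff_prod[of "\<lambda>z::complex. [:-z, 1:]" "{z. z ^ n = 1}"] assms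
    by (simp add: d)
  show "degree (monom 1 n - 1 :: complex poly) \<le> n"
    by (rule degree_diff_le) (auto simp: degree_monom_eq)
  show "card {z::complex. z ^ n = 1} \<ge> n" using card_roots_unity_eq[OF assms] by simp
  show "poly (\<Prod>z | z ^ n = 1. [:-z, 1:]) z = poly (monom 1 n - 1) z"
    if "z \<in> {z. z ^ n = 1}" for z :: complex
    using that fin by (auto simp: poly_prod poly_monom prod_zero_iff)
qed

lemma degree_monom_minus_one: "degree (monom 1 n - 1 :: complex poly) = n"
proof (cases "n = 0")
  case False
  then have "degree (- 1 + monom 1 n :: complex poly) = n"
    by (subst degree_add_eq_right) (auto simp: degree_monom_eq)
  then show ?thesis by simp
qed (simp add: monom_0 one_pCons)

lemma monom_minus_one_neq_0: "n > 0 \<Longrightarrow> (monom 1 n - 1 :: complex poly) \<noteq> 0"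
  using degree_monom_minus_one[of n] by auto

text \<open>The inclusion from left to right is Bezout in the subtraction-free form
  \<open>a * x = b * y + gcd a b\<close>, available for nonzero \<open>a\<close>.\<close>

lemma roots_unity_gcd:
  "{z::complex. z ^ a = 1} \<inter> {z. z ^ b = 1} = {z. z ^ gcd a b = 1}" (is "?L = ?R")
proof
  show "?R \<subseteq> ?L"
    by (auto elim!: dvdE[OF gcd_dvd1[of a b]] dvdE[OF gcd_dvd2[of a b]])
       (metis gcd_dvd1 gcd_dvd2 dvdE power_mult power_one)+
  show "?L \<subseteq> ?R"
  proof
    fix z :: complex assume z: "z \<in> ?L"
    show "z \<in> ?R"
    proof (cases "a = 0")
      case False
      from bezout_nat[OF this, of b] obtain x y where xy: "a * x = b * y + gcd a b" by blast
      have "1 = z ^ (a * x)" using z by (simp add: power_mult)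
      also have "\<dots> = z ^ gcd a b" unfolding xy using z by (simp add: power_add power_mult)
      finally show ?thesis by simp
    qed (use z in auto)
  qed
qed

lemma roots_unity_mono: "a dvd b \<Longrightarrow> {z::complex. z ^ a = 1} \<subseteq> {z. z ^ b = 1}"
  by (auto elim!: dvdE simp: power_mult)

section \<open>Orthogonality, Parseval's identity and distances of roots of unity from 1\<close>

lemma sum_roots_unity_orthogonal:
  assumes "n > 0" "j < n" "l < n"
  shows "(\<Sum>z | z ^ n = 1. z ^ j * cnj z ^ l) = (if j = l then of_nat n else 0)"
proof -
  define w where "w = cis (2 * pi / n)"
  have e: "cis (2 * pi * real k / real n) = w ^ k" for k
    by (simp add: w_def DeMoivre mult_ac)
  have inj: "inj_on (\<lambda>k. w ^ k) {..<n}" and wn: "w ^ n = 1"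
    using bij_betw_roots_unity[OF assms(1)] assms(1)
    by (auto simp: e bij_betw_def) (simp add: w_def DeMoivre)
  have cw: "w * cnj w = 1" by (simp add: w_def cis_cnj cis_mult)
  \<comment> \<open>The ratio of the geometric sum over the powers of \<open>w\<close>. It satisfies
    \<open>x ^ n = 1\<close>, and \<open>x = 1\<close> would force \<open>w ^ j = w ^ l\<close>,
    hence \<open>j = l\<close> for exponents below \<open>n\<close>.\<close>
  define x where "x = w ^ j * cnj w ^ l"
  have xw: "x * w ^ l = w ^ j"
    by (simp add: x_def mult.assoc flip: power_mult_distrib) (simp add: mult.commute cw)
  have "(\<Sum>z | z ^ n = 1. z ^ j * cnj z ^ l) = (\<Sum>k<n. x ^ k)"
    by (subst sum.reindex_bij_betw[OF bij_betw_roots_unity[OF assms(1)], symmetric])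
       (simp add: e x_def power_mult_distrib flip: power_mult, simp add: mult.commute)
  also have "\<dots> = (if j = l then of_nat n else 0)"
  proof (cases "j = l")
    case True
    then have "x = 1" by (simp add: x_def cw flip: power_mult_distrib)
    then show ?thesis using True by simp
  next
    case False
    then have "x \<noteq> 1" using xw inj_onD[OF inj, of l j] assms by auto
    moreover have "x ^ n = 1" using wn
      by (simp add: x_def power_mult_distrib flip: power_mult)
        (metis (no_types, lifting) complex_cnj_one complex_cnj_power mult.commute mult_1 power_mult power_one)
    ultimately show ?thesis using False by (simp add: geometric_sum)
  qed
  finally show ?thesis .
qed

text \<open>The squared modulus expands into a double sum over \<open>j\<close> and
  \<open>l\<close>; summing over \<open>z\<close> first leaves only the diagonal.\<close>

lemma parseval_roots_unity:
  assumes "n > 0"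
  shows "(\<Sum>z | z ^ n = 1. (cmod (\<Sum>j<n. a j * z ^ j))\<^sup>2) = n * (\<Sum>j<n. (cmod (a j))\<^sup>2)"
proof -
  have "complex_of_real (\<Sum>z | z ^ n = 1. (cmod (\<Sum>j<n. a j * z ^ j))\<^sup>2)
      = (\<Sum>z | z ^ n = 1. \<Sum>j<n. \<Sum>l<n. a j * cnj (a l) * (z ^ j * cnj z ^ l))"
    by (simp add: complex_norm_square sum_product mult_ac del: of_real_power)
  also have "\<dots> = (\<Sum>j<n. \<Sum>l<n. a j * cnj (a l) * (\<Sum>z | z ^ n = 1. z ^ j * cnj z ^ l))"
    by (subst sum.swap, rule sum.cong[OF refl], subst sum.swap) (simp add: sum_distrib_left)
  also have "\<dots> = (\<Sum>j<n. \<Sum>l<n. if j = l then a j * cnj (a l) * of_nat n else 0)"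
    using sum_roots_unity_orthogonal[OF assms] by (intro sum.cong refl) auto
  also have "\<dots> = complex_of_real (n * (\<Sum>j<n. (cmod (a j))\<^sup>2))"
    by (simp add: complex_norm_square sum_distrib_left mult_ac del: of_real_power)
  finally show ?thesis using of_real_eq_iff by blast
qed

text \<open>Parseval's identity applied to \<open>\<Sum>j<n. j * z ^ j = n / (z - 1)\<close>.\<close>
lemma sum_inverse_roots_unity:
  assumes "n > 0"
  shows "(\<Sum>z\<in>{z. z ^ n = 1} - {1}. 1 / (cmod (z - 1))\<^sup>2) = ((real n)\<^sup>2 - 1) / 12"
proof -
  have fin: "finite {z::complex. z ^ n = 1}" using finite_roots_unity[of n] assms by simp
  \<comment> \<open>Summation by parts. For \<open>z ^ n = 1\<close> and \<open>z \<noteq> 1\<close>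
    the geometric sum on the right vanishes.\<close>
  have tel: "(\<Sum>j<k. of_nat j * z ^ j) * (z - 1) = of_nat k * z ^ k - (\<Sum>j<k. z ^ Suc j)" for k and z :: complex
    by (induction k) (auto simp: algebra_simps)
  have val: "cmod (\<Sum>j<n. of_nat j * z ^ j) = n / cmod (z - 1)" if "z ^ n = 1" "z \<noteq> 1" for z
  proof -
    have "(\<Sum>j<n. z ^ Suc j) = z * (\<Sum>j<n. z ^ j)" by (simp add: sum_distrib_left)
    then have "(\<Sum>j<n. z ^ Suc j) = 0" using that by (simp add: geometric_sum)
    then have "(\<Sum>j<n. of_nat j * z ^ j) = of_nat n / (z - 1)"
      using tel[where k = n and z = z] that by (simp add: field_simps)
    then show ?thesis by (simp add: norm_divide)
  qed
  have s1: "(\<Sum>j<k. real j) = k * (real k - 1) / 2" for k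
    by (induction k) (auto simp: field_simps)
  have s2: "(\<Sum>j<k. (real j)\<^sup>2) = k * (real k - 1) * (2 * k - 1) / 6" for k
    by (induction k) (auto simp: field_simps power2_eq_square)
  have "n * (\<Sum>j<n. (real j)\<^sup>2) = (\<Sum>z | z ^ n = 1. (cmod (\<Sum>j<n. of_nat j * z ^ j))\<^sup>2)"
    using parseval_roots_unity[OF assms, of of_nat] by simp
  \<comment> \<open>The point \<open>z = 1\<close> is split off; there the inner sum is
    \<open>n * (n - 1) / 2\<close>.\<close>
  also have "\<dots> = (cmod (\<Sum>j<n. of_nat j))\<^sup>2 + (\<Sum>z\<in>{z. z ^ n = 1} - {1}. (cmod (\<Sum>j<n. of_nat j * z ^ j))\<^sup>2)"
    using fin by (subst sum.remove[of _ 1]) auto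
  also have "(\<Sum>z\<in>{z. z ^ n = 1} - {1}. (cmod (\<Sum>j<n. of_nat j * z ^ j))\<^sup>2)
     = n\<^sup>2 * (\<Sum>z\<in>{z. z ^ n = 1} - {1}. 1 / (cmod (z - 1))\<^sup>2)"
    by (simp add: sum_distrib_left val power_divide)
  also have "(\<Sum>j<n. of_nat j :: complex) = of_real (\<Sum>j<n. real j)" by simp
  also have "cmod \<dots> = \<bar>\<Sum>j<n. real j\<bar>" by (rule norm_of_real)
  finally have "n\<^sup>2 * (\<Sum>z\<in>{z. z ^ n = 1} - {1}. 1 / (cmod (z - 1))\<^sup>2)
     = n * (n * (real n - 1) * (2 * real n - 1) / 6) - (n * (real n - 1) / 2)\<^sup>2"
    by (simp add: s1 s2 power2_abs) (simp add: field_simps)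
  also have "\<dots> = real (n\<^sup>2) * (((real n)\<^sup>2 - 1) / 12)"
    by (simp add: field_simps power2_eq_square)
  finally show ?thesis using assms by simp
qed

text \<open>For odd \<open>n\<close> the terms of \<open>z\<close> and \<open>cnj z\<close> both occur in the preceding sum.\<close>
lemma dist_one_roots_unity:
  assumes "odd n" "z ^ n = 1" "z \<noteq> 1"
  shows "1 / (cmod (z - 1))\<^sup>2 \<le> (real n)\<^sup>2 / 24"
proof -
  have n: "n > 0" using assms(1) by (cases n) auto
  have fin: "finite {z::complex. z ^ n = 1}" using finite_roots_unity[of n] n by simp
  \<comment> \<open>For odd \<open>n\<close> the only real root is 1. So \<open>z\<close> and
    \<open>cnj z\<close> give two equal terms of a sum with value
    \<open>(n\<^sup>2 - 1) / 12\<close>, whence the 24.\<close>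
  have ne: "cnj z \<noteq> z"
  proof
    assume "cnj z = z"
    then obtain x where x: "z = of_real x" by (metis Reals_cases Reals_cnj_iff)
    with assms have "x ^ n = 1" "x \<noteq> 1" by (auto simp flip: of_real_power)
    moreover have "x ^ n = 1 \<Longrightarrow> x = 1"
      using odd_real_root_unique[OF assms(1), of x 1] odd_real_root_unique[OF assms(1), of 1 1] by simp
    ultimately show False by simp
  qed
  have cm: "cmod (cnj z - 1) = cmod (z - 1)"
    by (metis complex_cnj_diff complex_cnj_one complex_mod_cnj)
  have "cnj z ^ n = 1" using assms(2) by (metis complex_cnj_one complex_cnj_power)
  moreover have "cnj z \<noteq> 1" using assms(3) by simp
  ultimately have "(\<Sum>z\<in>{z, cnj z}. 1 / (cmod (z - 1))\<^sup>2) \<le> (\<Sum>z\<in>{z. z ^ n = 1} - {1}. 1 / (cmod (z - 1))\<^sup>2)"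
    using assms fin by (intro sum_mono2) auto
  then show ?thesis unfolding sum_inverse_roots_unity[OF n] using ne by (simp add: cm)
qed

text \<open>A nonzero \<open>y\<close> has exactly \<open>e\<close> roots of order \<open>e\<close>,
  so each \<open>f y\<close> is counted at most \<open>e\<close> times.\<close>

lemma sum_power_fibres_le:
  fixes f :: "complex \<Rightarrow> real"
  assumes "e > 0" "finite A" "finite B" "\<And>z. z \<in> A \<Longrightarrow> z ^ e \<in> B" "0 \<notin> B" "\<And>y. y \<in> B \<Longrightarrow> f y \<ge> 0"
  shows "(\<Sum>z\<in>A. f (z ^ e)) \<le> e * (\<Sum>y\<in>B. f y)"
proof -
  have "(\<Sum>z\<in>A. f (z ^ e)) = (\<Sum>y\<in>B. \<Sum>z\<in>{z \<in> A. z ^ e = y}. f (z ^ e))"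
    using assms by (intro sum.group[symmetric]) auto
  also have "\<dots> = (\<Sum>y\<in>B. card {z \<in> A. z ^ e = y} * f y)"
    by (intro sum.cong refl) simp
  also have "\<dots> \<le> (\<Sum>y\<in>B. e * f y)"
  proof (intro sum_mono mult_right_mono)
    fix y assume y: "y \<in> B"
    then have "y \<noteq> 0" using assms(5) by auto
    then have "card {z. z ^ e = y} = e" "finite {z. z ^ e = y}"
      using card_nth_roots[of y e] finite_nth_roots[of e y] assms(1) by auto
    then show "real (card {z \<in> A. z ^ e = y}) \<le> real e"
      using card_mono[of "{z. z ^ e = y}" "{z \<in> A. z ^ e = y}"] by auto
  qed (use assms in auto)
  finally show ?thesis by (simp add: sum_distrib_left)
qed

section \<open>Cyclotomic polynomials of order pq and pqr\<close>

text \<open>For \<open>n > 0\<close> this is the geometric series 1 / (1 - X^n).\<close>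

definition fps_period :: "nat \<Rightarrow> complex fps" where
  "fps_period n = Abs_fps (\<lambda>k. if n dvd k then 1 else 0)"

lemma fps_period_mult:
  assumes "n > 0"
  shows "(1 - fps_X ^ n) * fps_period n = 1"
proof (rule fps_ext)
  fix k
  have "n dvd k \<longleftrightarrow> n dvd k - n" if "\<not> k < n"
    using that by (auto simp: dvd_diff_nat elim: dvd_diffD)
  then show "fps_nth ((1 - fps_X ^ n) * fps_period n) k = fps_nth 1 k"
    using assms by (auto simp: fps_period_def algebra_simps fps_X_power_mult_nth dest: dvd_imp_le)
qed

lemma fps_period_cancel:
  assumes "n > 0" "f * (1 - fps_X ^ n) = g * h"
  shows "f = g * fps_period n * h"
proof -
  have "f = (f * (1 - fps_X ^ n)) * fps_period n"
    using fps_period_mult[OF assms(1)] by (simp only: mult.assoc mult_1_right)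
  then show ?thesis unfolding assms(2) by (simp only: mult_ac)
qed

text \<open>As \<open>degree a < n\<close> and \<open>r\<close> is invertible modulo \<open>n\<close>, each coefficient of \<open>a(x ^ r) / (1 - x ^ n)\<close>
  is either 0 or a single coefficient of \<open>a\<close>.\<close>
lemma coeff_pcompose_monom_period:
  fixes a :: "complex poly"
  assumes "coprime r n" "r > 0" "degree a < n" "0 \<in> S" "\<And>i. coeff a i \<in> S"
  shows "fps_nth (fps_of_poly (pcompose a (monom 1 r)) * fps_period n) k \<in> S"
proof -
  \<comment> \<open>The indices that may contribute to the convolution. As
    \<open>i div r < n\<close>, each is determined by its residue modulo \<open>n\<close>, which is
    that of \<open>k\<close>; so there is at most one.\<close>
  define T where "T = {i \<in> {0..k}. r dvd i \<and> i div r < n \<and> n dvd k - i}"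
  have "fps_nth (fps_of_poly (pcompose a (monom 1 r)) * fps_period n) k
      = (\<Sum>i\<in>T. coeff a (i div r))"
    unfolding fps_mult_nth fps_of_poly_nth coeff_pcompose_monom[OF assms(2)] T_def
    by (rule sum.mono_neutral_cong_right) (use assms(3) in \<open>auto simp: fps_period_def dest: le_degree\<close>)
  moreover have "i = j" if "i \<in> T" "j \<in> T" for i j
  proof -
    obtain u v where uv: "i = r * u" "j = r * v" "u < n" "v < n"
      using \<open>i \<in> T\<close> \<open>j \<in> T\<close> assms(2) by (auto simp: T_def elim!: dvdE)
    have "i mod n = k mod n" "j mod n = k mod n"
      using that mod_eq_dvd_iff_nat[of i k n] mod_eq_dvd_iff_nat[of j k n] by (auto simp: T_def)
    then have "[r * u = r * v] (mod n)" by (simp add: uv cong_def)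
    then have "[u = v] (mod n)" using assms(1) by (simp add: cong_mult_lcancel_nat)
    then show ?thesis using uv by (simp add: cong_less_modulus_unique_nat)
  qed
  then have "T = {} \<or> (\<exists>i. T = {i})" by blast
  ultimately show ?thesis using assms(4,5) by auto
qed

text \<open>For distinct primes \<open>p\<close> and \<open>q\<close> this is
  \<open>\<Phi>\<^sub>p\<^sub>q\<close>: the roots left over have order exactly
  \<open>p * q\<close>.\<close>

definition bicyclotomic :: "nat \<Rightarrow> nat \<Rightarrow> complex poly" where
  "bicyclotomic p q = (\<Prod>z\<in>{z. z ^ (p * q) = 1} - ({z. z ^ p = 1} \<union> {z. z ^ q = 1}). [:-z, 1:])"

text \<open>For distinct primes this is the cyclotomic polynomial of order \<open>p * q * r\<close>,
  since a proper divisor of that order divides one of the three pairwise products.\<close>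

definition tricyclotomic :: "nat \<Rightarrow> nat \<Rightarrow> nat \<Rightarrow> complex poly" where
  "tricyclotomic p q r = (\<Prod>z\<in>{z. z ^ (p * q * r) = 1} -
     ({z. z ^ (p * q) = 1} \<union> {z. z ^ (p * r) = 1} \<union> {z. z ^ (q * r) = 1}). [:-z, 1:])"

text \<open>Inclusion-exclusion on sets of roots: \<open>L\<close> turns unions and intersections
  into products, and the \<open>p\<close>-th and \<open>q\<close>-th roots of unity share only
  1.\<close>

lemma bicyclotomic_mult:
  assumes "p > 0" "q > 0" "coprime p q"
  shows "bicyclotomic p q * (monom 1 p - 1) * (monom 1 q - 1) = (monom 1 (p * q) - 1) * (monom 1 1 - 1)"
proof -
  define Z where "Z = (\<lambda>n. {z::complex. z ^ n = 1})"
  have Z: "{z. z ^ n = 1} = Z n" for n unfolding Z_def by (rule refl)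
  define L where "L = (\<lambda>A. \<Prod>z\<in>A. [:-z, 1::complex:])"
  have fin: "finite (Z n)" if "n > 0" for n
    unfolding Z_def using finite_roots_unity[of n] that by simp
  have L: "L (Z n) = monom 1 n - 1" if "n > 0" for n
    unfolding L_def Z_def using that by (rule prod_linear_roots_unity)
  have U: "L (A \<union> B) * L (A \<inter> B) = L A * L B" if "finite A" "finite B" for A B
    unfolding L_def using that by (rule prod.union_inter)
  have I: "Z a \<inter> Z b = Z (gcd a b)" for a b unfolding Z_def by (rule roots_unity_gcd)
  have sub: "Z p \<union> Z q \<subseteq> Z (p * q)"
    unfolding Z_def using roots_unity_mono[of p "p * q"] roots_unity_mono[of q "p * q"] by auto
  have "L (Z (p * q)) = bicyclotomic p q * L (Z p \<union> Z q)"
    unfolding bicyclotomic_def L_def Z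
    using sub fin[of "p * q"] assms by (intro prod.subset_diff) simp_all
  moreover have "L (Z p \<union> Z q) * L (Z 1) = L (Z p) * L (Z q)"
    using U[of "Z p" "Z q"] fin assms by (simp add: I)
  ultimately show ?thesis using assms by (simp add: L mult.assoc)
qed

text \<open>Inclusion-exclusion for three sets of roots, carried out two sets at a time and cleared
  of denominators.\<close>

lemma tricyclotomic_mult:
  assumes "p > 0" "q > 0" "r > 0" "coprime p q" "coprime p r" "coprime q r"
  shows "tricyclotomic p q r * ((monom 1 (p * q) - 1) * (monom 1 (p * r) - 1) *
      (monom 1 (q * r) - 1) * (monom 1 1 - 1)) =
    (monom 1 (p * q * r) - 1) * ((monom 1 p - 1) * (monom 1 q - 1) * (monom 1 r - 1))"
proof -
  define Z where "Z = (\<lambda>n. {z::complex. z ^ n = 1})"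
  have Z: "{z. z ^ n = 1} = Z n" for n unfolding Z_def by (rule refl)
  define L where "L = (\<lambda>A. \<Prod>z\<in>A. [:-z, 1::complex:])"
  have fin: "finite (Z n)" if "n > 0" for n
    unfolding Z_def using finite_roots_unity[of n] that by simp
  have L: "L (Z n) = monom 1 n - 1" if "n > 0" for n
    unfolding L_def Z_def using that by (rule prod_linear_roots_unity)
  have U: "L (A \<union> B) * L (A \<inter> B) = L A * L B" if "finite A" "finite B" for A B
    unfolding L_def using that by (rule prod.union_inter)
  have I: "Z a \<inter> Z b = Z (gcd a b)" for a b unfolding Z_def by (rule roots_unity_gcd)
  define D where "D = Z (p * q) \<union> Z (p * r) \<union> Z (q * r)"
  have sub: "D \<subseteq> Z (p * q * r)"
    unfolding D_def Z_def using roots_unity_mono[of "p * q" "p * q * r"]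
      roots_unity_mono[of "p * r" "p * q * r"] roots_unity_mono[of "q * r" "p * q * r"]
    by (simp add: mult_ac)
  have pos: "p * q > 0" "p * r > 0" "q * r > 0" "p * q * r > 0" using assms by auto
  have g: "gcd (p * q) (p * r) = p" "gcd (p * q) (q * r) = q" "gcd (p * r) (q * r) = r"
    using assms gcd_mult_distrib_nat[of p q r] gcd_mult_distrib_nat[of q p r] gcd_mult_distrib_nat[of r p q]
    by (simp_all add: mult.commute)
  have 1: "L (Z (p * q * r)) = tricyclotomic p q r * L D"
    unfolding tricyclotomic_def L_def Z D_def[symmetric]
    using sub fin[OF pos(4)] by (intro prod.subset_diff) simp_all
  have 2: "L (Z (p * q) \<union> Z (p * r)) * L (Z p) = L (Z (p * q)) * L (Z (p * r))"
    using U[of "Z (p * q)" "Z (p * r)"] fin pos by (simp add: I g)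
  have 3: "L (Z q \<union> Z r) * L (Z 1) = L (Z q) * L (Z r)"
    using U[of "Z q" "Z r"] fin assms by (simp add: I)
  \<comment> \<open>The third set meets the union of the first two in
    \<open>Z q \<union> Z r\<close>, whose product is resolved by the preceding fact.\<close>
  have 4: "L D * L (Z q \<union> Z r) = L (Z (p * q) \<union> Z (p * r)) * L (Z (q * r))"
    using U[of "Z (p * q) \<union> Z (p * r)" "Z (q * r)"] fin pos by (simp add: I g D_def Int_Un_distrib2)
  have "tricyclotomic p q r * (L (Z (p * q)) * L (Z (p * r)) * L (Z (q * r)) * L (Z 1))
     = tricyclotomic p q r * L (Z p) * L (Z 1) * (L (Z (p * q) \<union> Z (p * r)) * L (Z (q * r)))"
    by (simp only: 2[symmetric] mult_ac)
  also have "\<dots> = (tricyclotomic p q r * L D) * L (Z p) * (L (Z q \<union> Z r) * L (Z 1))"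
    using arg_cong[OF 4, of "\<lambda>x. tricyclotomic p q r * L (Z p) * L (Z 1) * x"] by (simp only: mult_ac)
  also have "\<dots> = L (Z (p * q * r)) * (L (Z p) * L (Z q) * L (Z r))"
    unfolding 1[symmetric] 3 by (simp only: mult_ac)
  finally have "tricyclotomic p q r * (L (Z (p * q)) * L (Z (p * r)) * L (Z (q * r)) * L (Z 1))
     = L (Z (p * q * r)) * (L (Z p) * L (Z q) * L (Z r))" .
  then show ?thesis using assms pos by (simp add: L)
qed

text \<open>Degrees are compared on both sides of \<open>tricyclotomic_mult\<close>.\<close>

lemma degree_tricyclotomic:
  assumes "p > 0" "q > 0" "r > 0" "coprime p q" "coprime p r" "coprime q r"
  shows "degree (tricyclotomic p q r) = (p - 1) * (q - 1) * (r - 1)"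
proof -
  have pos: "p * q > 0" "p * r > 0" "q * r > 0" "p * q * r > 0" "(1::nat) > 0" using assms by auto
  have "tricyclotomic p q r \<noteq> 0"
    using finite_roots_unity[where 'a = complex and n = "p * q * r"] assms by (auto simp: tricyclotomic_def prod_zero_iff)
  moreover note tricyclotomic_mult[OF assms, THEN arg_cong[where f = degree]]
  ultimately have "degree (tricyclotomic p q r) + (p * q + p * r + q * r + 1) = p * q * r + (p + q + r)"
    using monom_minus_one_neq_0[OF pos(1)] monom_minus_one_neq_0[OF pos(2)] monom_minus_one_neq_0[OF pos(3)]
      monom_minus_one_neq_0[OF pos(4)] monom_minus_one_neq_0[OF pos(5)]
      monom_minus_one_neq_0[OF assms(1)] monom_minus_one_neq_0[OF assms(2)] monom_minus_one_neq_0[OF assms(3)]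
    by (simp add: degree_mult_eq degree_monom_minus_one)
  moreover obtain a b c where "p = Suc a" "q = Suc b" "r = Suc c" using assms by (metis gr0_implies_Suc)
  ultimately show ?thesis by (simp add: algebra_simps)
qed

text \<open>This is \<open>\<Phi>\<^sub>p\<^sub>q\<^sub>r(x) \<Phi>\<^sub>p\<^sub>q(x ^ 1) =
  \<Phi>\<^sub>p\<^sub>q(x ^ r)\<close> with the second factor replaced by its quotient formula and
  denominators cleared.\<close>

lemma tricyclotomic_bicyclotomic:
  assumes "p > 0" "q > 0" "r > 0" "coprime p q" "coprime p r" "coprime q r"
  shows "tricyclotomic p q r * ((monom 1 (p * q) - 1) * (monom 1 1 - 1)) =
    pcompose (bicyclotomic p q) (monom 1 r) * ((monom 1 p - 1) * (monom 1 q - 1))"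
proof -
  have c: "pcompose (monom 1 k - 1) (monom 1 r) = (monom 1 (r * k) - 1 :: complex poly)" for k
    by (simp add: pcompose_diff pcompose_1 pcompose_monom_monom)
  have 1: "pcompose (bicyclotomic p q) (monom 1 r) * (monom 1 (p * r) - 1) * (monom 1 (q * r) - 1)
       = (monom 1 (p * q * r) - 1) * (monom 1 r - 1)"
    using bicyclotomic_mult[OF assms(1,2,4), THEN arg_cong[where f = "\<lambda>x. pcompose x (monom 1 r)"]]
    by (simp add: pcompose_mult c mult_ac)
  have "(monom 1 (p * r) - 1) * (monom 1 (q * r) - 1) \<noteq> (0 :: complex poly)"
    using monom_minus_one_neq_0 assms by simp
  moreover have "(tricyclotomic p q r * ((monom 1 (p * q) - 1) * (monom 1 1 - 1))) *
      ((monom 1 (p * r) - 1) * (monom 1 (q * r) - 1)) =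
    (monom 1 (p * q * r) - 1) * ((monom 1 p - 1) * (monom 1 q - 1) * (monom 1 r - 1))"
    using tricyclotomic_mult[OF assms] by (simp only: mult_ac)
  moreover have "\<dots> = (pcompose (bicyclotomic p q) (monom 1 r) * ((monom 1 p - 1) * (monom 1 q - 1))) *
      ((monom 1 (p * r) - 1) * (monom 1 (q * r) - 1))"
    using arg_cong[OF 1, of "\<lambda>x. x * ((monom 1 p - 1) * (monom 1 q - 1))"] by (simp only: mult_ac)
  ultimately show ?thesis using mult_right_cancel by metis
qed

section \<open>Coefficient bounds for orders pq and pqr\<close>

lemma geometric_monom:
  "(monom 1 k - 1) * pcompose (\<Sum>i<n. monom 1 i) (monom 1 k) = (monom 1 (k * n) - 1 :: complex poly)"
  by (induction n)
    (simp_all add: pcompose_add pcompose_monom_monom monom_0 algebra_simps mult_monom one_pCons)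

text \<open>The polynomial equals \<open>h * (1 - fps_X)\<close>, where \<open>h\<close> = a(x^q) /
  (1 - x^p) has coefficients 0 and 1 only; differences of consecutive ones have modulus at most
  1.\<close>

lemma norm_coeff_bicyclotomic:
  assumes "p > 0" "q > 0" "coprime p q"
  shows "cmod (coeff (bicyclotomic p q) k) \<le> 1"
proof -
  define a :: "complex poly" where "a = (\<Sum>i<p. monom 1 i)"
  define h where "h = fps_of_poly (pcompose a (monom 1 q)) * fps_period p"
  have "a = (\<Sum>i\<le>p - 1. monom 1 i)"
    using assms(1) by (simp add: a_def flip: lessThan_Suc_atMost)
  then have "degree a \<le> p - 1"
    by (auto intro!: degree_sum_le simp: degree_monom_eq)
  then have dega: "degree a < p" using assms(1) by simp
  have "coeff a i \<in> {0, 1}" for i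
    by (simp add: a_def coeff_sum sum.delta')
  then have h: "fps_nth h i \<in> {0, 1}" for i
    unfolding h_def using assms dega
    by (intro coeff_pcompose_monom_period) (auto simp: coprime_commute)
  have "(monom 1 q - 1) * (bicyclotomic p q * (monom 1 p - 1))
    = (monom 1 q - 1) * (pcompose a (monom 1 q) * (monom 1 1 - 1))"
    using bicyclotomic_mult[OF assms] geometric_monom[of q p]
    by (simp add: a_def mult_ac)
  then have "bicyclotomic p q * (monom 1 p - 1) = pcompose a (monom 1 q) * (monom 1 1 - 1)"
    using monom_minus_one_neq_0[OF assms(2)] by simp
  from arg_cong[OF this, of fps_of_poly]
  have "fps_of_poly (bicyclotomic p q) * (1 - fps_X ^ p) = fps_of_poly (pcompose a (monom 1 q)) * (1 - fps_X)"
    by (simp add: fps_of_poly_mult fps_of_poly_diff fps_of_poly_monom' algebra_simps)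
  then have "fps_of_poly (bicyclotomic p q) = h * (1 - fps_X)"
    using fps_period_cancel[OF assms(1)] unfolding h_def by blast
  then have "coeff (bicyclotomic p q) k = fps_nth (h * (1 - fps_X)) k"
    by (metis fps_of_poly_nth)
  also have "\<dots> = fps_nth h k - (if k = 0 then 0 else fps_nth h (k - 1))"
    by (simp add: algebra_simps)
  finally show ?thesis using h[of k] h[of "k - 1"] by auto
qed

text \<open>The series \<open>h\<close> has coefficients of modulus at most 1, and the remaining
  factor \<open>a * (1 - x ^ q)\<close> is a signed sum of \<open>2 * p\<close> monomials, each of
  which only shifts \<open>h\<close>.\<close>

lemma norm_coeff_tricyclotomic:
  assumes "p > 0" "q > 0" "r > 0" "coprime p q" "coprime p r" "coprime q r"
  shows "cmod (coeff (tricyclotomic p q r) k) \<le> 2 * p"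
proof -
  define a :: "complex poly" where "a = (\<Sum>i<p. monom 1 i)"
  define h where "h = fps_of_poly (pcompose (bicyclotomic p q) (monom 1 r)) * fps_period (p * q)"
  have "bicyclotomic p q \<noteq> 0"
    using finite_roots_unity[where 'a = complex and n = "p * q"] assms by (auto simp: bicyclotomic_def prod_zero_iff)
  then have "degree (bicyclotomic p q) + (p + q) = p * q + 1"
    using bicyclotomic_mult[OF assms(1,2,4), THEN arg_cong[where f = degree]]
      monom_minus_one_neq_0[of "p * q"] monom_minus_one_neq_0[of 1]
      monom_minus_one_neq_0[OF assms(1)] monom_minus_one_neq_0[OF assms(2)] assms
    by (simp add: degree_mult_eq degree_monom_minus_one)
  then have deg: "degree (bicyclotomic p q) < p * q" using assms by linarith
  have "fps_nth h i \<in> {z. cmod z \<le> 1}" for i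
    unfolding h_def using assms deg norm_coeff_bicyclotomic[OF assms(1,2,4)]
    by (intro coeff_pcompose_monom_period) (auto simp: coprime_commute)
  then have h: "cmod (if b then 0 else fps_nth h i) \<le> 1" for b i by simp
  have a: "(monom 1 1 - 1) * a = monom 1 p - 1"
    using geometric_monom[of 1 p] by (simp add: a_def monom_altdef)
  have "(monom 1 1 - 1) * (tricyclotomic p q r * (monom 1 (p * q) - 1))
    = (monom 1 1 - 1) * (pcompose (bicyclotomic p q) (monom 1 r) * (a * (monom 1 q - 1)))"
    using tricyclotomic_bicyclotomic[OF assms] by (simp only: a[symmetric] mult_ac)
  then have "tricyclotomic p q r * (monom 1 (p * q) - 1) =
      pcompose (bicyclotomic p q) (monom 1 r) * (a * (monom 1 q - 1))"
    using monom_minus_one_neq_0[of 1] by simp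
  from arg_cong[OF this, of fps_of_poly]
  have "fps_of_poly (tricyclotomic p q r) * (1 - fps_X ^ (p * q))
      = fps_of_poly (pcompose (bicyclotomic p q) (monom 1 r)) * (fps_of_poly a * (1 - fps_X ^ q))"
    by (simp add: fps_of_poly_mult fps_of_poly_diff fps_of_poly_monom' algebra_simps)
  then have "fps_of_poly (tricyclotomic p q r) = h * (fps_of_poly a * (1 - fps_X ^ q))"
    using fps_period_cancel[of "p * q"] assms unfolding h_def by simp
  also have "\<dots> = (\<Sum>u<p. h * fps_X ^ u - h * fps_X ^ (q + u))"
    by (simp add: a_def fps_of_poly_sum fps_of_poly_monom' sum_distrib_left sum_distrib_right
        algebra_simps power_add sum_subtractf)
  finally have "coeff (tricyclotomic p q r) k = fps_nth (\<Sum>u<p. h * fps_X ^ u - h * fps_X ^ (q + u)) k"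
    by (metis fps_of_poly_nth)
  also have "\<dots> = (\<Sum>u<p. (if k < u then 0 else fps_nth h (k - u))
      - (if k < q + u then 0 else fps_nth h (k - (q + u))))"
    by (simp add: fps_sum_nth fps_X_power_mult_right_nth)
  also have "cmod \<dots> \<le> (\<Sum>u<p. 2)"
    by (rule sum_norm_le, rule order_trans[OF norm_triangle_ineq4]) (use h in \<open>smt (verit)\<close>)
  finally show ?thesis by simp
qed

section \<open>A lower bound for the derivative at the roots\<close>

lemma tricyclotomic_root:
  assumes "p > 0" "q > 0" "r > 0"
    and "w ^ (p * q * r) = 1" "w ^ (p * q) \<noteq> 1" "w ^ (p * r) \<noteq> 1" "w ^ (q * r) \<noteq> 1"
  shows "poly (tricyclotomic p q r) w = 0"
  using assms finite_roots_unity[where 'a = complex and n = "p * q * r"]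
  by (auto simp: tricyclotomic_def poly_prod prod_zero_iff intro!: bexI[of _ w])

lemma norm_pderiv_tricyclotomic:
  assumes "p > 0" "q > 0" "r > 0" "coprime p q" "coprime p r" "coprime q r"
    and w: "w ^ (p * q * r) = 1" "w ^ (p * q) \<noteq> 1" "w ^ (p * r) \<noteq> 1" "w ^ (q * r) \<noteq> 1"
  shows "real (p * q * r) * (cmod (w ^ p - 1) * cmod (w ^ q - 1) * cmod (w ^ r - 1))
    \<le> 16 * cmod (poly (pderiv (tricyclotomic p q r)) w)"
proof -
  define G :: "complex poly" where "G = (monom 1 (p * q) - 1) * (monom 1 (p * r) - 1) *
      (monom 1 (q * r) - 1) * (monom 1 1 - 1)"
  define H :: "complex poly" where "H = (monom 1 p - 1) * (monom 1 q - 1) * (monom 1 r - 1)"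
  have w1: "cmod w = 1"
    using power_eq_1_iff[OF w(1)] assms by simp
  have b: "cmod (w ^ j - 1) \<le> 2" for j
    using norm_triangle_ineq4[of "w ^ j" 1] w1 by (simp add: norm_power)
  have "cmod (poly G w) = cmod (w ^ (p * q) - 1) * cmod (w ^ (p * r) - 1) * cmod (w ^ (q * r) - 1) * cmod (w ^ 1 - 1)"
    by (simp add: G_def poly_monom norm_mult)
  \<comment> \<open>Each of the four factors is a distance between points of the unit circle; this
    is the source of the 16.\<close>
  also have "\<dots> \<le> 2 * 2 * 2 * 2"
    by (intro mult_mono b) auto
  finally have G: "cmod (poly G w) \<le> 16" by simp
  have "tricyclotomic p q r * G = (monom 1 (p * q * r) - 1) * H"
    unfolding G_def H_def by (rule tricyclotomic_mult[OF assms(1-6)])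
  from arg_cong[OF this, of "\<lambda>P. poly (pderiv P) w"]
  \<comment> \<open>In the product rule, the terms containing the undifferentiated
    \<open>tricyclotomic p q r\<close> or \<open>w ^ (p * q * r) - 1\<close> vanish.\<close>
  have "poly (pderiv (tricyclotomic p q r)) w * poly G w = of_nat (p * q * r) * w ^ (p * q * r - 1) * poly H w"
    using tricyclotomic_root[OF assms(1-3) w] w(1)
    by (simp add: pderiv_mult pderiv_diff pderiv_monom poly_monom mult.commute)
  from arg_cong[OF this, of cmod]
  have "cmod (poly (pderiv (tricyclotomic p q r)) w) * cmod (poly G w)
    = real (p * q * r) * (cmod (w ^ p - 1) * cmod (w ^ q - 1) * cmod (w ^ r - 1))"
    by (simp add: norm_mult norm_power w1 H_def poly_monom del: of_nat_mult)
  moreover have "cmod (poly (pderiv (tricyclotomic p q r)) w) * cmod (poly G w)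
     \<le> cmod (poly (pderiv (tricyclotomic p q r)) w) * 16"
    using G by (intro mult_left_mono) auto
  ultimately show ?thesis by linarith
qed

section \<open>Inverses of Vandermonde matrices\<close>

text \<open>Horner's recursion expresses coefficient \<open>j\<close> of the quotient as coefficient
  \<open>j + 1\<close> of \<open>P\<close> plus \<open>c\<close> times the next quotient
  coefficient; with \<open>cmod c = 1\<close> downward induction on \<open>j\<close>
  applies.\<close>

lemma norm_coeff_synthetic_div:
  fixes P :: "complex poly"
  assumes "cmod c = 1"
  shows "cmod (coeff (synthetic_div P c) j) \<le> (\<Sum>i\<in>{j<..degree P}. cmod (coeff P i))"
proof (induction "degree P - j" arbitrary: j)
  case 0
  \<comment> \<open>Here \<open>j\<close> is at least \<open>degree P\<close>, so the quotient has
    no coefficient at \<open>j\<close>; for constant \<open>P\<close> the quotient is 0.\<close>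
  then show ?case by (cases "degree P = 0")
    (auto simp: coeff_eq_0 degree_synthetic_div synthetic_div_eq_0_iff[THEN iffD2] intro!: sum_nonneg)
next
  case (Suc d)
  have "coeff P (Suc j) + c * coeff (synthetic_div P c) (Suc j) = coeff (synthetic_div P c) j"
    using arg_cong[OF synthetic_div_correct[of P c], of "\<lambda>P. coeff P (Suc j)"] by simp
  then have "cmod (coeff (synthetic_div P c) j) \<le> cmod (coeff P (Suc j)) + cmod (coeff (synthetic_div P c) (Suc j))"
    using norm_triangle_ineq[of "coeff P (Suc j)" "c * coeff (synthetic_div P c) (Suc j)"] assms
    by (simp add: norm_mult)
  also have "\<dots> \<le> cmod (coeff P (Suc j)) + (\<Sum>i\<in>{Suc j<..degree P}. cmod (coeff P i))"
    using Suc.hyps by (intro add_left_mono) simp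
  also have "\<dots> = (\<Sum>i\<in>insert (Suc j) {Suc j<..degree P}. cmod (coeff P i))" by simp
  also have "insert (Suc j) {Suc j<..degree P} = {j<..degree P}" using Suc.hyps by auto
  finally show ?case .
qed

text \<open>The inverse consists of the coefficients of the Lagrange polynomials
  \<open>P / ((x - \<zeta> i) * P' (\<zeta> i))\<close>.\<close>
lemma cond_number_vandermonde:
  fixes P :: "complex poly"
  assumes "degree P = m" "inj_on \<zeta> {1..m}"
    and root: "\<And>i. i \<in> {1..m} \<Longrightarrow> poly P (\<zeta> i) = 0"
    and deriv: "\<And>i. i \<in> {1..m} \<Longrightarrow> poly (pderiv P) (\<zeta> i) \<noteq> 0"
  shows "cond_number (vandermonde_mat m \<zeta>) = frobenius_norm (vandermonde_mat m \<zeta>) *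
    frobenius_norm (mat m m (\<lambda>(j, i). coeff (synthetic_div P (\<zeta> (i + 1))) j / poly (pderiv P) (\<zeta> (i + 1))))"
    (is "_ = _ * frobenius_norm ?W")
proof -
  have V: "vandermonde_mat m \<zeta> \<in> carrier_mat m m" and W: "?W \<in> carrier_mat m m"
    by (auto simp: vandermonde_mat_def)
  have "vandermonde_mat m \<zeta> * ?W = 1\<^sub>m m"
  proof (rule eq_matI)
    fix i k assume "i < dim_row (1\<^sub>m m)" "k < dim_col (1\<^sub>m m)"
    then have ik: "i < m" "k < m" by auto
    define Q where "Q = synthetic_div P (\<zeta> (k + 1))"
    have P: "P = [:- \<zeta> (k + 1), 1:] * Q"
      using synthetic_div_correct'[of "\<zeta> (k + 1)" P] root[of "k + 1"] ik by (simp add: Q_def)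
    have "degree Q < m" using ik assms(1) by (simp add: Q_def degree_synthetic_div)
    then have Qi: "(\<Sum>j<m. \<zeta> (i + 1) ^ j * coeff Q j) = poly Q (\<zeta> (i + 1))"
      unfolding poly_altdef
      by (intro sum.mono_neutral_cong_right) (auto simp: mult.commute dest: le_degree)
    have "(vandermonde_mat m \<zeta> * ?W) $$ (i, k) = (\<Sum>j<m. \<zeta> (i + 1) ^ j * (coeff Q j / poly (pderiv P) (\<zeta> (k + 1))))"
      using ik by (simp add: vandermonde_mat_def scalar_prod_def Q_def atLeast0LessThan)
    also have "\<dots> = poly Q (\<zeta> (i + 1)) / poly (pderiv P) (\<zeta> (k + 1))"
      by (simp only: Qi[symmetric] sum_divide_distrib times_divide_eq_right)
    \<comment> \<open>From P = (x - \<zeta>) Q at the node of index \<open>k + 1\<close>: the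
      product rule gives P' = Q at that node, and Q vanishes at all the others.\<close>
    also have "\<dots> = (if i = k then 1 else 0)"
    proof (cases "i = k")
      case True
      have "poly (pderiv P) (\<zeta> (k + 1)) = poly Q (\<zeta> (k + 1))"
        by (subst P, subst pderiv_mult) (simp add: pderiv_pCons)
      then show ?thesis using True deriv[of "k + 1"] ik by simp
    next
      case False
      then have "\<zeta> (i + 1) \<noteq> \<zeta> (k + 1)" using inj_onD[OF assms(2), of "i + 1" "k + 1"] ik by auto
      moreover have "(\<zeta> (i + 1) - \<zeta> (k + 1)) * poly Q (\<zeta> (i + 1)) = 0"
        using root[of "i + 1"] ik arg_cong[OF P, of "\<lambda>P. poly P (\<zeta> (i + 1))"]
        by (auto simp: algebra_simps)
      ultimately have "poly Q (\<zeta> (i + 1)) = 0" by (simp only: mult_eq_0_iff right_minus_eq) simp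
      then show ?thesis using False by simp
    qed
    finally show "(vandermonde_mat m \<zeta> * ?W) $$ (i, k) = 1\<^sub>m m $$ (i, k)" using ik by simp
  qed (auto simp: vandermonde_mat_def)
  moreover from mat_mult_left_right_inverse[OF V W this] have "?W * vandermonde_mat m \<zeta> = 1\<^sub>m m" .
  ultimately show ?thesis by (rule cond_number_eq[OF V W])
qed

text \<open>All \<open>m * m\<close> entries of the matrix have modulus 1, so its norm is
  \<open>m\<close>. Every quotient coefficient is at most \<open>B\<close>, leaving the constant
  coefficient of \<open>P\<close> out since only coefficients above \<open>j\<close> enter; summing
  over the \<open>m\<close> rows of the inverse gives the factor \<open>m\<close> under the
  root.\<close>

lemma cond_number_vandermonde_le:
  fixes P :: "complex poly"
  assumes "degree P = m" "inj_on \<zeta> {1..m}"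
    and root: "\<And>i. i \<in> {1..m} \<Longrightarrow> poly P (\<zeta> i) = 0"
    and deriv: "\<And>i. i \<in> {1..m} \<Longrightarrow> poly (pderiv P) (\<zeta> i) \<noteq> 0"
    and unit: "\<And>i. i \<in> {1..m} \<Longrightarrow> cmod (\<zeta> i) = 1"
    and B: "(\<Sum>i\<in>{0<..m}. cmod (coeff P i)) \<le> B"
    and D: "(\<Sum>i\<in>{1..m}. 1 / (cmod (poly (pderiv P) (\<zeta> i)))\<^sup>2) \<le> D"
  shows "cond_number (vandermonde_mat m \<zeta>) \<le> m * (B * sqrt (m * D))"
proof -
  let ?W = "mat m m (\<lambda>(j, i). coeff (synthetic_div P (\<zeta> (i + 1))) j / poly (pderiv P) (\<zeta> (i + 1)))"
  have "(\<Sum>i<m. \<Sum>j<m. (cmod (\<zeta> (i + 1) ^ j))\<^sup>2) = (\<Sum>i<m. \<Sum>j<m. 1)"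
    using unit by (intro sum.cong refl) (simp add: norm_power)
  then have V: "frobenius_norm (vandermonde_mat m \<zeta>) = m"
    by (simp add: frobenius_norm_def vandermonde_mat_def)
  have "0 \<le> (\<Sum>i\<in>{0<..m}. cmod (coeff P i))" by (simp add: sum_nonneg)
  with B have B0: "0 \<le> B" by linarith
  have Q: "cmod (coeff (synthetic_div P (\<zeta> (i + 1))) j) \<le> B" if "i < m" for i j
  proof -
    have "cmod (coeff (synthetic_div P (\<zeta> (i + 1))) j) \<le> (\<Sum>i\<in>{j<..m}. cmod (coeff P i))"
      using norm_coeff_synthetic_div[of "\<zeta> (i + 1)" P j] unit[of "i + 1"] that assms(1) by simp
    also have "\<dots> \<le> (\<Sum>i\<in>{0<..m}. cmod (coeff P i))" by (intro sum_mono2) auto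
    finally show ?thesis using B by linarith
  qed
  have "(\<Sum>j<m. \<Sum>i<m. (cmod (?W $$ (j, i)))\<^sup>2) \<le> (\<Sum>j<m. \<Sum>i<m. B\<^sup>2 * (1 / (cmod (poly (pderiv P) (\<zeta> (i + 1))))\<^sup>2))"
    using Q by (intro sum_mono) (auto simp: norm_divide power_divide intro!: divide_right_mono power_mono)
  also have "\<dots> = m * (B\<^sup>2 * (\<Sum>i\<in>{1..m}. 1 / (cmod (poly (pderiv P) (\<zeta> i)))\<^sup>2))"
    by (simp add: sum_distrib_left sum.atLeast1_atMost_eq)
  also have "\<dots> \<le> m * (B\<^sup>2 * D)"
    by (intro mult_left_mono D) auto
  finally have "frobenius_norm ?W \<le> sqrt (m * (B\<^sup>2 * D))"
    unfolding frobenius_norm_def by (simp only: dim_row_mat dim_col_mat) (rule real_sqrt_le_mono)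
  also have "\<dots> = B * sqrt (m * D)"
    using B0 by (simp add: real_sqrt_mult)
  finally have W: "frobenius_norm ?W \<le> B * sqrt (m * D)" .
  have "cond_number (vandermonde_mat m \<zeta>) = frobenius_norm (vandermonde_mat m \<zeta>) * frobenius_norm ?W"
    using assms(1,2) root deriv by (rule cond_number_vandermonde)
  then show ?thesis using mult_left_mono[OF W, of m] by (simp add: V)
qed

section \<open>The condition number\<close>

text \<open>The substitution only spreads the coefficients out, so the bound on their sum does not
  grow with \<open>k\<close>.\<close>

lemma sum_coeff_pcompose_monom:
  fixes F :: "complex poly"
  assumes "k > 0"
  shows "(\<Sum>i\<in>{0<..k * d}. cmod (coeff (pcompose F (monom 1 k)) i)) = (\<Sum>u\<in>{0<..d}. cmod (coeff F u))"
proof -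
  have "(\<Sum>i\<in>{0<..k * d}. cmod (coeff (pcompose F (monom 1 k)) i))
      = (\<Sum>i\<in>(*) k ` {0<..d}. cmod (coeff (pcompose F (monom 1 k)) i))"
    using assms by (intro sum.mono_neutral_right) (auto simp: coeff_pcompose_monom elim!: dvdE)
  also have "\<dots> = (\<Sum>u\<in>{0<..d}. cmod (coeff F u))"
    using assms by (subst sum.reindex) (auto simp: inj_on_def coeff_pcompose_monom)
  finally show ?thesis .
qed

section \<open>Averaging the reciprocal squared derivatives over the roots\<close>

lemma power_neq_1_factors:
  fixes w :: "'a :: monoid_mult"
  assumes "w ^ (p * q) \<noteq> 1" "w ^ (p * r) \<noteq> 1" "w ^ (q * r) \<noteq> 1"
  shows "w ^ p \<noteq> 1" "w ^ q \<noteq> 1" "w ^ r \<noteq> 1"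
  using assms power_mult[of w p q] power_mult[of w q r] power_mult[of w r p]
  by (auto simp: mult.commute[of r p])

lemma sum_inverse_pderiv_tricyclotomic:
  assumes pos: "p > 0" "q > 0" "r > 0" "k > 0" and odd: "odd p" "odd q" "odd r"
    and cop: "coprime p q" "coprime p r" "coprime q r"
    and fin: "finite A"
    and A: "\<And>z. z \<in> A \<Longrightarrow> (z ^ k) ^ (p * q * r) = 1 \<and> (z ^ k) ^ (p * q) \<noteq> 1 \<and>
      (z ^ k) ^ (p * r) \<noteq> 1 \<and> (z ^ k) ^ (q * r) \<noteq> 1"
  shows "(\<Sum>z\<in>A. 1 / (cmod (poly (pderiv (tricyclotomic p q r)) (z ^ k)))\<^sup>2)
    \<le> real k * real p * (real (p * q * r))\<^sup>2 / 27" (is "?S \<le> _")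
proof -
  define N where "N = p * q * r"
  have N: "real N > 0" using pos by (simp add: N_def)
  \<comment> \<open>The pointwise bounds are used for \<open>w ^ q\<close> and \<open>w ^ r\<close>,
    whose orders divide \<open>p * r\<close> and \<open>p * q\<close>; the constant is 256 / 24^2 =
    4 / 9.\<close>
  have summand: "1 / (cmod (poly (pderiv (tricyclotomic p q r)) w))\<^sup>2
      \<le> 4 / 9 * (real p)\<^sup>2 * (1 / (cmod (w ^ p - 1))\<^sup>2)"
    if w: "w ^ (p * q * r) = 1" "w ^ (p * q) \<noteq> 1" "w ^ (p * r) \<noteq> 1" "w ^ (q * r) \<noteq> 1" for w
  proof -
    let ?d = "cmod (poly (pderiv (tricyclotomic p q r)) w)"
    let ?x = "cmod (w ^ p - 1)" and ?y = "cmod (w ^ q - 1)" and ?z = "cmod (w ^ r - 1)"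
    have xyz: "?x > 0" "?y > 0" "?z > 0" using power_neq_1_factors[OF w(2-4)] by auto
    have y: "1 / ?y\<^sup>2 \<le> (real (p * r))\<^sup>2 / 24"
      using w power_neq_1_factors[OF w(2-4)] odd by (intro dist_one_roots_unity) (auto simp: mult_ac simp flip: power_mult)
    have z: "1 / ?z\<^sup>2 \<le> (real (p * q))\<^sup>2 / 24"
      using w power_neq_1_factors[OF w(2-4)] odd by (intro dist_one_roots_unity) (auto simp: mult_ac simp flip: power_mult)
    have le: "N * (?x * ?y * ?z) / 16 \<le> ?d"
      using norm_pderiv_tricyclotomic[OF pos(1-3) cop w] by (simp add: N_def)
    have "N * (?x * ?y * ?z) / 16 > 0" using xyz N by simp
    moreover from this le have "?d > 0" by (rule order.strict_trans2)
    ultimately have "1 / ?d\<^sup>2 \<le> 1 / (N * (?x * ?y * ?z) / 16)\<^sup>2"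
      using le by (intro divide_left_mono power_mono mult_pos_pos zero_less_power) linarith+
    also have "\<dots> = 256 / N\<^sup>2 * (1 / ?x\<^sup>2) * ((1 / ?y\<^sup>2) * (1 / ?z\<^sup>2))"
      by (simp add: power_mult_distrib power_divide)
    also have "\<dots> \<le> 256 / N\<^sup>2 * (1 / ?x\<^sup>2) * ((real (p * r))\<^sup>2 / 24 * ((real (p * q))\<^sup>2 / 24))"
      by (intro mult_left_mono mult_mono y z) auto
    also have "\<dots> = 4 / 9 * (real p)\<^sup>2 * (1 / ?x\<^sup>2)"
      using pos by (simp add: N_def field_simps power2_eq_square)
    finally show ?thesis .
  qed
  define R where "R = {z. z ^ (q * r) = 1} - {1::complex}"
  have R: "finite R" "0 \<notin> R"
    using finite_roots_unity[where 'a = complex and n = "q * r"] pos by (auto simp: R_def power_0_left)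
  have mem: "z ^ (k * p) \<in> R" if "z \<in> A" for z
    using A[OF that] power_neq_1_factors[of "z ^ k" p q r] by (auto simp: R_def mult_ac simp flip: power_mult)
  have "?S \<le> (\<Sum>z\<in>A. 4 / 9 * (real p)\<^sup>2 * (1 / (cmod (z ^ (k * p) - 1))\<^sup>2))"
    using summand A by (intro sum_mono) (simp add: power_mult)
  also have "\<dots> = 4 / 9 * (real p)\<^sup>2 * (\<Sum>z\<in>A. 1 / (cmod (z ^ (k * p) - 1))\<^sup>2)"
    by (simp add: sum_distrib_left)
  \<comment> \<open>The map \<open>z \<mapsto> z ^ (k * p)\<close> sends \<open>A\<close> into the
    nontrivial roots of order \<open>q * r\<close> and takes each value at most \<open>k * p\<close>
    times.\<close>
  also have "\<dots> \<le> 4 / 9 * (real p)\<^sup>2 * (real (k * p) * (\<Sum>z\<in>R. 1 / (cmod (z - 1))\<^sup>2))"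
    using pos fin R mem
    by (intro mult_left_mono sum_power_fibres_le[where f = "\<lambda>z. 1 / (cmod (z - 1))\<^sup>2"]) auto
  also have "\<dots> \<le> 4 / 9 * (real p)\<^sup>2 * (real (k * p) * ((real (q * r))\<^sup>2 / 12))"
    using pos sum_inverse_roots_unity[of "q * r"] by (intro mult_left_mono) (auto simp: R_def)
  also have "\<dots> = real k * real p * (real (p * q * r))\<^sup>2 / 27"
    by (simp add: power2_eq_square)
  finally show ?thesis .
qed

text \<open>The ratios p/(p-1), q/(q-1), r/(r-1) are at most 3/2, 5/4, 5/4, with product 75/32 < 3;
  moreover \<open>p ^ 3 \<le> p * q * r\<close>.\<close>

lemma tricyclotomic_estimate:
  fixes p q r :: nat
  assumes "p \<ge> 3" "q \<ge> 5" "r \<ge> 5" "p < q" "q < r"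
  shows "(real (p * q * r))\<^sup>2 * real p ^ 3 \<le> 27 * real ((p - 1) * (q - 1) * (r - 1)) ^ 3"
proof -
  have "2 * p \<le> 3 * (p - 1)" "4 * q \<le> 5 * (q - 1)" "4 * r \<le> 5 * (r - 1)" using assms by auto
  then have "2 * p * (4 * q) * (4 * r) \<le> 3 * (p - 1) * (5 * (q - 1)) * (5 * (r - 1))"
    by (rule mult_le_mono[OF mult_le_mono])
  then have "32 * (p * q * r) \<le> 75 * ((p - 1) * (q - 1) * (r - 1))" by (simp add: mult_ac)
  then have N: "p * q * r \<le> 3 * ((p - 1) * (q - 1) * (r - 1))" by linarith
  have "p ^ 3 \<le> p * q * r"
    using assms by (simp add: power3_eq_cube) (intro mult_mono; simp)
  then have "(p * q * r)\<^sup>2 * p ^ 3 \<le> (p * q * r)\<^sup>2 * (p * q * r)" by (rule mult_left_mono) simp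
  also have "\<dots> = (p * q * r) ^ 3" by (simp add: power2_eq_square power3_eq_cube)
  also have "\<dots> \<le> (3 * ((p - 1) * (q - 1) * (r - 1))) ^ 3" using N by (rule power_mono) simp
  finally have "(p * q * r)\<^sup>2 * p ^ 3 \<le> 27 * ((p - 1) * (q - 1) * (r - 1)) ^ 3"
    by (simp only: power_mult_distrib) simp
  from of_nat_mono[OF this, where 'a = real] show ?thesis by simp
qed

theorem theorem4p6:
  fixes p q r l s t n m :: nat and \<zeta> :: "nat \<Rightarrow> complex"
  assumes "prime p" and "prime q" and "prime r"
    and "odd p" and "odd q" and "odd r"
    and "p < q" and "q < r"
    and "l \<ge> 1" and "s \<ge> 1" and "t \<ge> 1"
    and "n = p ^ l * q ^ s * r ^ t"
    and "m = totient n"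
    and "bij_betw \<zeta> {1..m} (primitive_roots_of_unity n)"
  shows "cond_number (vandermonde_mat m \<zeta>) \<le> 2 * (real (totient (rad n)))\<^sup>2 * (real m)\<^sup>2"
proof -
  define F where "F = tricyclotomic p q r"
  define k where "k = p ^ (l - 1) * q ^ (s - 1) * r ^ (t - 1)"
  define M where "M = (p - 1) * (q - 1) * (r - 1)"
  define P where "P = pcompose F (monom 1 k)"
  have pos: "p > 0" "q > 0" "r > 0" and pos1: "p > 1" "q > 1" "r > 1"
    using assms(1-3) prime_gt_1_nat by (auto intro: prime_gt_0_nat)
  have cop: "coprime p q" "coprime p r" "coprime q r"
    using assms(1-3,7,8) by (auto intro: primes_coprime)
  \<comment> \<open>Parity gives \<open>p \<ge> 3\<close>; then \<open>q > p\<close> and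
    \<open>q \<noteq> 4\<close> give \<open>q \<ge> 5\<close>.\<close>
  have "p \<noteq> 2" "q \<noteq> 4" using assms(4,5) by auto
  then have ge: "p \<ge> 3" "q \<ge> 5" "r \<ge> 5" using pos1 assms(7,8) by linarith+
  have pw: "p ^ l = p * p ^ (l - 1)" "q ^ s = q * q ^ (s - 1)" "r ^ t = r * r ^ (t - 1)"
    using assms(9-11) by (simp_all add: power_eq_if)
  have k: "k > 0" using pos by (simp add: k_def)
  have n: "n = k * (p * q * r)" unfolding assms(12) k_def pw by (simp only: mult_ac)
  have npos: "n > 0" using n k pos by simp
  have "prime_factors n = {p, q, r}"
    using assms by (auto simp: prime_factors_product prime_factors_power prime_prime_factors)
  then have rad: "rad n = p * q * r"
    using assms(7,8) by (simp add: rad_def mult.assoc)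
  have M: "totient (rad n) = M"
    using assms(1-3) cop by (simp add: rad M_def totient_mult_coprime totient_prime)
  have m: "m = k * M"
    using assms(1-3,9-11) cop
    by (simp add: assms(12,13) k_def M_def totient_mult_coprime totient_prime totient_power)
  have prim: "(\<zeta> i ^ k) ^ (p * q * r) = 1 \<and> (\<zeta> i ^ k) ^ (p * q) \<noteq> 1 \<and>
      (\<zeta> i ^ k) ^ (p * r) \<noteq> 1 \<and> (\<zeta> i ^ k) ^ (q * r) \<noteq> 1" if "i \<in> {1..m}" for i
  proof -
    have z: "\<zeta> i \<in> primitive_roots_of_unity n" using assms(14) that by (rule bij_betwE[rule_format])
    \<comment> \<open>Applied to the pairwise products \<open>e\<close>, for which
      \<open>k * e\<close> is a proper divisor of \<open>n\<close>.\<close>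
    have "0 < k * e \<Longrightarrow> k * e < n \<Longrightarrow> (\<zeta> i ^ k) ^ e \<noteq> 1" for e
      using z by (auto simp: primitive_roots_of_unity_def simp flip: power_mult)
    then show ?thesis using z k pos pos1
      by (auto simp: primitive_roots_of_unity_def n simp flip: power_mult)
  qed
  have unit: "cmod (\<zeta> i) = 1" if "i \<in> {1..m}" for i
  proof -
    have "\<zeta> i ^ n = 1" using prim[OF that] by (simp add: n flip: power_mult)
    then show ?thesis using npos power_eq_1_iff by blast
  qed
  have degF: "degree F = M"
    unfolding F_def M_def by (rule degree_tricyclotomic[OF pos cop])
  then have degP: "degree P = m" by (simp add: P_def degree_pcompose degree_monom_eq m mult.commute)
  have root: "poly P (\<zeta> i) = 0" if "i \<in> {1..m}" for i
    using tricyclotomic_root[OF pos, of "\<zeta> i ^ k"] prim[OF that]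
    by (simp add: P_def F_def poly_pcompose poly_monom)
  \<comment> \<open>The chain rule gives P'(z) = k z^(k-1) F'(z^k); on the unit circle the factor
    \<open>k \<ge> 1\<close> is simply dropped.\<close>
  have deriv: "cmod (poly (pderiv F) (\<zeta> i ^ k)) \<le> cmod (poly (pderiv P) (\<zeta> i))" if "i \<in> {1..m}" for i
    using k mult_left_mono[of 1 "real k" "cmod (poly (pderiv F) (\<zeta> i ^ k))"] unit[OF that]
    by (simp add: P_def pderiv_pcompose poly_pcompose poly_monom pderiv_monom norm_mult norm_power)
  have deriv0: "poly (pderiv F) (\<zeta> i ^ k) \<noteq> 0" if "i \<in> {1..m}" for i
  proof
    define w where "w = \<zeta> i ^ k"
    assume "poly (pderiv F) (\<zeta> i ^ k) = 0"
    then have "real (p * q * r) * (cmod (w ^ p - 1) * cmod (w ^ q - 1) * cmod (w ^ r - 1)) \<le> 0"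
      using norm_pderiv_tricyclotomic[OF pos cop, of w] prim[OF that] by (simp add: F_def w_def)
    moreover have "w ^ p \<noteq> 1" "w ^ q \<noteq> 1" "w ^ r \<noteq> 1"
      using prim[OF that] power_neq_1_factors[of w p q r] by (auto simp: w_def)
    then have "real (p * q * r) * (cmod (w ^ p - 1) * cmod (w ^ q - 1) * cmod (w ^ r - 1)) > 0"
      using pos by (intro mult_pos_pos) auto
    ultimately show False by linarith
  qed
  have inj: "inj_on \<zeta> {1..m}" using assms(14) by (rule bij_betw_imp_inj_on)
  define B where "B = 2 * real p * real M"
  have "(\<Sum>u\<in>{0<..M}. cmod (coeff F u)) \<le> (\<Sum>u\<in>{0<..M}. 2 * real p)"
    using norm_coeff_tricyclotomic[OF pos cop] by (intro sum_mono) (simp add: F_def)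
  then have B: "(\<Sum>i\<in>{0<..m}. cmod (coeff P i)) \<le> B"
    unfolding m P_def sum_coeff_pcompose_monom[OF k] by (simp add: B_def mult_ac)
  have "(\<Sum>i\<in>{1..m}. 1 / (cmod (poly (pderiv P) (\<zeta> i)))\<^sup>2)
      \<le> (\<Sum>i\<in>{1..m}. 1 / (cmod (poly (pderiv F) (\<zeta> i ^ k)))\<^sup>2)"
  proof (rule sum_mono)
    fix i assume i: "i \<in> {1..m}"
    have "cmod (poly (pderiv F) (\<zeta> i ^ k)) > 0" using deriv0[OF i] by simp
    then show "1 / (cmod (poly (pderiv P) (\<zeta> i)))\<^sup>2 \<le> 1 / (cmod (poly (pderiv F) (\<zeta> i ^ k)))\<^sup>2"
      using deriv[OF i] by (intro divide_left_mono power_mono mult_pos_pos zero_less_power) auto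
  qed
  also have "\<dots> = (\<Sum>z\<in>\<zeta> ` {1..m}. 1 / (cmod (poly (pderiv F) (z ^ k)))\<^sup>2)"
    by (subst sum.reindex[OF inj]) simp
  also have "\<dots> \<le> real k * real p * (real (p * q * r))\<^sup>2 / 27"
    unfolding F_def by (rule sum_inverse_pderiv_tricyclotomic[OF pos k assms(4-6) cop]) (use prim in auto)
  finally have D: "(\<Sum>i\<in>{1..m}. 1 / (cmod (poly (pderiv P) (\<zeta> i)))\<^sup>2) \<le> real k * real p * (real (p * q * r))\<^sup>2 / 27" .
  have "poly (pderiv P) (\<zeta> i) \<noteq> 0" if "i \<in> {1..m}" for i
    using deriv[OF that] deriv0[OF that] by auto
  from cond_number_vandermonde_le[OF degP inj root this unit B D]
  have "cond_number (vandermonde_mat m \<zeta>) \<le> m * (B * sqrt (m * (real k * real p * (real (p * q * r))\<^sup>2 / 27)))"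
    by simp
  \<comment> \<open>The \<open>p\<close> in the denominator cancels the one in \<open>B\<close>,
    which leaves 2 m k M^3 = 2 M^2 m^2.\<close>
  also have "\<dots> \<le> m * (B * (k * (real M)\<^sup>2 / p))"
  proof (intro mult_left_mono real_le_lsqrt)
    \<comment> \<open>Regrouped to expose the left-hand side of
      \<open>tricyclotomic_estimate\<close>.\<close>
    have "m * (real k * real p * (real (p * q * r))\<^sup>2 / 27)
       = k\<^sup>2 * M / (p\<^sup>2 * 27) * ((real (p * q * r))\<^sup>2 * real p ^ 3)"
      using pos by (simp add: m power2_eq_square power3_eq_cube)
    also have "\<dots> \<le> k\<^sup>2 * M / (p\<^sup>2 * 27) * (27 * real M ^ 3)"
      unfolding M_def by (intro mult_left_mono tricyclotomic_estimate ge assms(7,8)) auto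
    also have "\<dots> = (k * (real M)\<^sup>2 / p)\<^sup>2"
      by (simp add: power2_eq_square power3_eq_cube)
    finally show "m * (real k * real p * (real (p * q * r))\<^sup>2 / 27) \<le> (k * (real M)\<^sup>2 / p)\<^sup>2" .
  qed (auto simp: B_def)
  also have "\<dots> = 2 * (real (totient (rad n)))\<^sup>2 * (real m)\<^sup>2"
    using pos by (simp add: B_def m M power2_eq_square)
  finally show ?thesis .
qed

end
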